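(* Fix a date $t<T$ and a history $h_t$. (1) For every bounded reward system, every fixed continuation policy $\pi$, and all vintages $s,s'\le t$, $$\bigl|V_{s,t}^{\pi}(h_t)-V_{s',t}^{\pi}(h_t)\bigr|\le d_{t,h_t}^{+}(s,s').$$ Consequently an $\varepsilon$-cover recovers the root-date coordinates $\{V_{s,t}^\pi(h_t):s\le t\}$ from $N_{t,h_t}^{\rm vit}(\varepsilon)$ representatives with error at most $\varepsilon$. Uniform recovery, with error at most $\varepsilon$, of the coordinates $V_{s,j}^\pi(h_j)$ of these root-active vintages $s\le t$ at every descendant root $h_j\succeq h_t$, $j\ge t$, is obtained by taking an $\varepsilon$-cover of $\{0,\dots,t\}$ under $$\bar d_{t,h_t}^{+}(s,s'):=\sup_{j\ge t,\ h_j\succeq h_t}d_{j,h_j}^{+}(s,s'),\qquad s,s'\le t.$$ (2) More generally, suppose a compressed backward recursion has current-self action values $\widetilde Q_u(h_u,a)$ satisfying, for each date $u$, $$\sup_{h_u,a}\bigl|\widetilde Q_u(h_u,a)-Q_u^{u,\pi}(h_u,a)\bigr|\le\varepsilon_u .$$ If $\pi$ is an exact SPE, it is a $2\varepsilon_u$-SPE of the compressed recursion at each date $u$, i.e. $\widetilde Q_u(h_u,\pi_u(h_u))\ge\max_a\widetilde Q_u(h_u,a)-2\varepsilon_u$ for all $h_u$. If at every subgame the exact action gap is strict and greater than $2\varepsilon_u$ (that is, $Q_u^{u,\pi}(h_u,\pi_u(h_u))-Q_u^{u,\pi}(h_u,a)>2\varepsilon_u$ for all $a\ne\pi_u(h_u)$),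 then the pure SPE is preserved: $\pi_u(h_u)$ is the unique maximizer of $\widetilde Q_u(h_u,\cdot)$ at every subgame. If moreover vintage $0$ is retained exactly (its kernels $\mathcal K_{0,u}$ are kept unchanged), then its precommitment value and its evaluation of the preserved policy can be recomputed exactly, so the root Price of Relearning is unchanged.
   Context: Finite controlled event tree: dates $t=0,\dots,T$; finitely many histories at each date; at each $h_t$ with $t<T$ a finite nonempty action set $\mathcal A_t(h_t)$; after action $a$, an observation $y$ in a finite set $\mathcal Y_{t+1}(h_t,a)$, leading to $(h_t,a,y)$. $h_j\succeq h_t$ means $h_j$ equals or descends from $h_t$. Rewards satisfy $|r_t(h,a)|\le R_t$, $|g(h_T)|\le G$; discount $\beta\in(0,1]$; $B_T:=G$, $B_t:=R_t+\beta B_{t+1}$. For $0\le s\le t<T$, $\mathcal K_{s,t}(h_t,a)\subseteq\Delta(\mathcal Y_{t+1}(h_t,a))$ is nonempty compact (one-step kernels of vintage $s$ at date $t$). For a pure policy $\pi$: $V_{s,T}^\pi=g$, $Q_t^{s,\pi}(h_t,a)=r_t(h_t,a)+\beta\inf_{q\in\mathcal K_{s,t}(h_t,a)}\sum_yq(y)V_{s,t+1}^\pi(h_t,a,y)$, $V_{s,t}^\pi(h_t)=Q_t^{s,\pi}(h_t,\pi_t(h_t))$. $\pi$ is an SPE if $\pi_t(h_t)\in\arg\max_aQ_t^{t,\pi}(h_t,a)$ at all histories. The vintage-$0$ precommitment value is $\max_{\pi'}V_{0,0}^{\pi'}(h_0)$, and the root Price of Relearning of an SPE $\pi$ is $\max_{\pi'}V_{0,0}^{\pi'}(h_0)-V_{0,0}^\pi(h_0)$.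 For nonempty compact $A,B$ in a simplex, $D_{\rm op}(A,B)=\sup_{\|z\|_\infty\le1}|\inf_{p\in A}p^\top z-\inf_{p\in B}p^\top z|$. For $s,s'\le t$, $$d_{t,h_t}^{+}(s,s'):=\sum_{j=t}^{T-1}\beta^{j-t+1}B_{j+1}\sup_{h_j\succeq h_t,\ a\in\mathcal A_j(h_j)}D_{\rm op}(\mathcal K_{s,j}(h_j,a),\mathcal K_{s',j}(h_j,a)).$$ $R\subseteq\{0,\dots,t\}$ is an $\varepsilon$-cover if every vintage in $\{0,\dots,t\}$ is within $\varepsilon$ of some $r\in R$ under $d_{t,h_t}^+$; $N_{t,h_t}^{\rm vit}(\varepsilon)$ is the minimum cardinality of an $\varepsilon$-cover. Recovery means decoding the coordinate of $s$ by that of a representative within $\varepsilon$. *)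

theory Defs
  imports "HOL-Analysis.Analysis" "HOL-Library.Sublist"
begin

text \<open>
  Histories are lists of (action, observation) pairs with the most recent pair at the head: the
  root is \<open>[]\<close>, the successor \<open>(h, a, y)\<close> of \<open>h\<close> is \<open>(a, y) # h\<close>, the date of \<open>h\<close> is \<open>length h\<close>, and
  \<open>h'\<close> equals or descends from \<open>h\<close> iff \<open>suffix h h'\<close>.  Because histories carry their date, date
  subscripts on action sets, rewards, kernels, values and policies are omitted.
\<close>

type_synonym ('a, 'y) history = "('a \<times> 'y) list"
type_synonym ('a, 'y) policy = "('a, 'y) history \<Rightarrow> 'a"

record ('a, 'y) tree =
  horizon :: nat
  actions :: "('a, 'y) history \<Rightarrow> 'a set"
  obs :: "('a, 'y) history \<Rightarrow> 'a \<Rightarrow> 'y set"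
  kernels :: "nat \<Rightarrow> ('a, 'y) history \<Rightarrow> 'a \<Rightarrow> ('y \<Rightarrow> real) set"
  discount :: real
  reward_bound :: "nat \<Rightarrow> real"
  terminal_bound :: real

record ('a, 'y) rewards =
  reward :: "('a, 'y) history \<Rightarrow> 'a \<Rightarrow> real"
  terminal :: "('a, 'y) history \<Rightarrow> real"

primrec histories :: "('a, 'y) tree \<Rightarrow> nat \<Rightarrow> ('a, 'y) history set" where
  "histories M 0 = {[]}"
| "histories M (Suc t) =
     {(a, y) # h | h a y. h \<in> histories M t \<and> a \<in> actions M h \<and> y \<in> obs M h a}"

definition descendants :: "('a, 'y) tree \<Rightarrow> ('a, 'y) history \<Rightarrow> nat \<Rightarrow> ('a, 'y) history set" where
  "descendants M h j = {h' \<in> histories M j. suffix h h'}"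

text \<open>
  Probability vectors on \<open>Y\<close> are functions vanishing off \<open>Y\<close>.  For finite \<open>Y\<close> the product topology
  on \<open>'y \<Rightarrow> real\<close> therefore restricts to the Euclidean topology of the simplex.
\<close>

definition prob_simplex :: "'y set \<Rightarrow> ('y \<Rightarrow> real) set" where
  "prob_simplex Y = {q. (\<forall>y\<in>Y. 0 \<le> q y) \<and> (\<forall>y. y \<notin> Y \<longrightarrow> q y = 0) \<and> (\<Sum>y\<in>Y. q y) = 1}"

text \<open>Finiteness of the set of histories at each date follows from that of actions and observations.\<close>

definition controlled_event_tree :: "('a, 'y) tree \<Rightarrow> bool" where
  "controlled_event_tree M \<longleftrightarrow>
     0 < discount M \<and> discount M \<le> 1 \<and>
     (\<forall>t<horizon M. \<forall>h\<in>histories M t.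
        finite (actions M h) \<and> actions M h \<noteq> {} \<and>
        (\<forall>a\<in>actions M h. finite (obs M h a) \<and>
           (\<forall>s\<le>t. kernels M s h a \<noteq> {} \<and> compact (kernels M s h a) \<and>
                   kernels M s h a \<subseteq> prob_simplex (obs M h a))))"

definition bounded_rewards :: "('a, 'y) tree \<Rightarrow> ('a, 'y) rewards \<Rightarrow> bool" where
  "bounded_rewards M w \<longleftrightarrow>
     (\<forall>t<horizon M. \<forall>h\<in>histories M t. \<forall>a\<in>actions M h. \<bar>reward w h a\<bar> \<le> reward_bound M t) \<and>
     (\<forall>h\<in>histories M (horizon M). \<bar>terminal w h\<bar> \<le> terminal_bound M)"

definition policies :: "('a, 'y) tree \<Rightarrow> ('a, 'y) policy set" where
  "policies M = {\<pi>. \<forall>t<horizon M. \<forall>h\<in>histories M t. \<pi> h \<in> actions M h}"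

function value_bound :: "('a, 'y) tree \<Rightarrow> nat \<Rightarrow> real" where
  "value_bound M t =
     (if t < horizon M then reward_bound M t + discount M * value_bound M (Suc t)
      else terminal_bound M)"
  by auto
termination
  by (relation "Wellfounded.measure (\<lambda>(M, t). horizon M - t)") auto

declare value_bound.simps [simp del]

definition lower_exp :: "'y set \<Rightarrow> ('y \<Rightarrow> real) set \<Rightarrow> ('y \<Rightarrow> real) \<Rightarrow> real" where
  "lower_exp Y K z = (INF q\<in>K. \<Sum>y\<in>Y. q y * z y)"

text \<open>
  \<open>V M w \<pi> s h\<close> is the vintage-\<open>s\<close> value of \<open>\<pi>\<close> at \<open>h\<close>, and \<open>Q M w \<pi> s h a\<close> the vintage-\<open>s\<close> action
  value at \<open>h\<close> when \<open>\<pi>\<close> is followed afterwards.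
\<close>

function V :: "('a, 'y) tree \<Rightarrow> ('a, 'y) rewards \<Rightarrow> ('a, 'y) policy \<Rightarrow> nat \<Rightarrow> ('a, 'y) history \<Rightarrow> real"
  and Q :: "('a, 'y) tree \<Rightarrow> ('a, 'y) rewards \<Rightarrow> ('a, 'y) policy \<Rightarrow> nat \<Rightarrow> ('a, 'y) history \<Rightarrow> 'a \<Rightarrow> real"
where
  "V M w \<pi> s h = (if length h < horizon M then Q M w \<pi> s h (\<pi> h) else terminal w h)"
| "Q M w \<pi> s h a =
     reward w h a +
     discount M * lower_exp (obs M h a) (kernels M s h a) (\<lambda>y. V M w \<pi> s ((a, y) # h))"
  by pat_completeness auto
termination
  by (relation "Wellfounded.measure (\<lambda>x. case x of
        Inl (M, w, \<pi>, s, h) \<Rightarrow> 2 * (horizon M - length h)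
      | Inr (M, w, \<pi>, s, h, a) \<Rightarrow> max 1 (2 * (horizon M - length h) - 1))") auto

declare V.simps [simp del] Q.simps [simp del]

definition SPE :: "('a, 'y) tree \<Rightarrow> ('a, 'y) rewards \<Rightarrow> ('a, 'y) policy \<Rightarrow> bool" where
  "SPE M w \<pi> \<longleftrightarrow> \<pi> \<in> policies M \<and>
     (\<forall>u<horizon M. \<forall>h\<in>histories M u. is_arg_max (Q M w \<pi> u h) (\<lambda>a. a \<in> actions M h) (\<pi> h))"

text \<open>
  The set under \<open>Max\<close> is finite: a value at the root depends on the policy only through its
  restriction to the finitely many histories of the tree.
\<close>

definition precommitment_value :: "('a, 'y) tree \<Rightarrow> ('a, 'y) rewards \<Rightarrow> real" where
  "precommitment_value M w = Max ((\<lambda>\<pi>'. V M w \<pi>' 0 []) ` policies M)"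

definition price_of_relearning :: "('a, 'y) tree \<Rightarrow> ('a, 'y) rewards \<Rightarrow> ('a, 'y) policy \<Rightarrow> real" where
  "price_of_relearning M w \<pi> = precommitment_value M w - V M w \<pi> 0 []"

definition D_op :: "'y set \<Rightarrow> ('y \<Rightarrow> real) set \<Rightarrow> ('y \<Rightarrow> real) set \<Rightarrow> real" where
  "D_op Y A B = (SUP z\<in>{z. \<forall>y\<in>Y. \<bar>z y\<bar> \<le> 1}. \<bar>lower_exp Y A z - lower_exp Y B z\<bar>)"

definition d_plus :: "('a, 'y) tree \<Rightarrow> ('a, 'y) history \<Rightarrow> nat \<Rightarrow> nat \<Rightarrow> real" where
  "d_plus M h s s' =
     (\<Sum>j = length h..<horizon M. discount M ^ (j - length h + 1) * value_bound M (j + 1) *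
        (SUP (h', a)\<in>(SIGMA h':descendants M h j. actions M h').
           D_op (obs M h' a) (kernels M s h' a) (kernels M s' h' a)))"

text \<open>At terminal histories \<open>d_plus\<close> is an empty sum, so including the date \<open>horizon M\<close> is harmless.\<close>

definition d_bar_plus :: "('a, 'y) tree \<Rightarrow> ('a, 'y) history \<Rightarrow> nat \<Rightarrow> nat \<Rightarrow> real" where
  "d_bar_plus M h s s' =
     (SUP h'\<in>(\<Union>j\<in>{length h..horizon M}. descendants M h j). d_plus M h' s s')"

definition eps_cover :: "(nat \<Rightarrow> nat \<Rightarrow> real) \<Rightarrow> nat \<Rightarrow> real \<Rightarrow> nat set \<Rightarrow> bool" where
  "eps_cover d t \<epsilon> R \<longleftrightarrow> R \<subseteq> {0..t} \<and> (\<forall>s\<le>t. \<exists>r\<in>R. d s r \<le> \<epsilon>)"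

text \<open>\<open>\<rho>\<close> assigns to each vintage a representative within \<open>\<epsilon>\<close>, by whose coordinate it is decoded.\<close>

definition decoder :: "(nat \<Rightarrow> nat \<Rightarrow> real) \<Rightarrow> nat \<Rightarrow> real \<Rightarrow> nat set \<Rightarrow> (nat \<Rightarrow> nat) \<Rightarrow> bool" where
  "decoder d t \<epsilon> R \<rho> \<longleftrightarrow> (\<forall>s\<le>t. \<rho> s \<in> R \<and> d s (\<rho> s) \<le> \<epsilon>)"

definition N_vit :: "('a, 'y) tree \<Rightarrow> ('a, 'y) history \<Rightarrow> real \<Rightarrow> nat" where
  "N_vit M h \<epsilon> = (LEAST n. \<exists>R. eps_cover (d_plus M h) (length h) \<epsilon> R \<and> card R = n)"

end

theory Submission imports Defs begin

text \<open>
  Part (1) is a telescoping argument along the tree.  A lower expectation is nonexpansive in the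
  sup norm of its integrand (\<open>lower_exp_nonexpansive\<close>), and replacing one kernel set by another
  changes it by at most the operational distance times a bound on the integrand
  (\<open>lower_exp_change_kernels\<close>).  Continuation values at date \<open>j\<close> are bounded by
  \<open>value_bound M j\<close> (\<open>abs_V_le_value_bound\<close>).  Write \<open>b\<close> for the discount, \<open>e(h)\<close> for the
  discrepancy of the values of two vintages at \<open>h\<close>, and \<open>D(h)\<close> for the operational distance of
  their kernels at the action taken there.  Changing the vintage first in the continuation and then
  in the current step gives, at date \<open>t\<close>,

  \<open>e(h) \<le> b * (maximum of e over the successors of h) + b * value_bound M (t + 1) * D(h)\<close>.

  The weights in \<open>d_plus\<close> solve this recursion when at each date the worst one-step distance among
  all descendants is charged; \<open>d_plus_step\<close> is the inequality that lets the two recursions be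
  compared.  The statements on covers are then applications of the Lipschitz bound
  \<open>V_vintage_lipschitz\<close>, at \<open>h\<close> or at all of its descendants.

  Part (2) compares maximizers: moving every action value by at most \<open>\<epsilon>\<close> moves each difference
  of two of them by at most \<open>2 * \<epsilon>\<close>, so a strict gap exceeding that amount keeps its sign.  The
  price of relearning involves vintage \<open>0\<close> only, and the vintage-\<open>0\<close> values are computed from
  the vintage-\<open>0\<close> kernels and from the choices made inside the tree (\<open>V_cong\<close>); the latter
  are pinned down by the uniqueness of the maximizers.
\<close>

section \<open>Lower expectations and the operational distance\<close>

lemma prob_simplex_expectation_mono:
  assumes q: "q \<in> prob_simplex Y" and le: "\<And>y. y \<in> Y \<Longrightarrow> z y \<le> z' y + c"
  shows "(\<Sum>y\<in>Y. q y * z y) \<le> (\<Sum>y\<in>Y. q y * z' y) + c"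
proof -
  have "(\<Sum>y\<in>Y. q y * z y) \<le> (\<Sum>y\<in>Y. q y * (z' y + c))"
    using q le by (intro sum_mono mult_left_mono) (auto simp: prob_simplex_def)
  also have "\<dots> = (\<Sum>y\<in>Y. q y * z' y) + (\<Sum>y\<in>Y. q y) * c"
    by (simp add: distrib_left sum.distrib sum_distrib_right)
  finally show ?thesis using q by (simp add: prob_simplex_def)
qed

text \<open>A sum over an infinite set has the default value \<open>0\<close>, which is not the mass of a distribution.\<close>

lemma prob_simplex_finite: "q \<in> prob_simplex Y \<Longrightarrow> finite Y"
  using sum.infinite[of Y q] by (force simp: prob_simplex_def)

lemma prob_simplex_nonempty: "q \<in> prob_simplex Y \<Longrightarrow> Y \<noteq> {}"
  by (auto simp: prob_simplex_def)

lemma bdd_below_expectations: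
  assumes "K \<subseteq> prob_simplex Y"
  shows "bdd_below ((\<lambda>q. \<Sum>y\<in>Y. q y * z y) ` K)"
proof (cases "K = {}")
  case False
  then obtain q where "q \<in> prob_simplex Y" using assms by auto
  then have fin: "finite Y" by (rule prob_simplex_finite)
  define c where "c = (\<Sum>y\<in>Y. \<bar>z y\<bar>)"
  have "- c \<le> (\<Sum>y\<in>Y. q y * z y)" if "q \<in> K" for q
  proof -
    have "(\<Sum>y\<in>Y. q y * 0) \<le> (\<Sum>y\<in>Y. q y * z y) + c"
    proof (rule prob_simplex_expectation_mono)
      show "q \<in> prob_simplex Y" using that assms by auto
      fix y assume "y \<in> Y"
      then have "\<bar>z y\<bar> \<le> c" unfolding c_def using fin by (intro member_le_sum) auto
      then show "0 \<le> z y + c" by linarith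
    qed
    then show ?thesis by simp
  qed
  then show ?thesis by (intro bdd_belowI2)
qed simp

lemma lower_exp_lower:
  "K \<subseteq> prob_simplex Y \<Longrightarrow> q \<in> K \<Longrightarrow> lower_exp Y K z \<le> (\<Sum>y\<in>Y. q y * z y)"
  unfolding lower_exp_def by (intro cINF_lower bdd_below_expectations)

lemma lower_exp_mono_shift:
  assumes "K \<noteq> {}" "K \<subseteq> prob_simplex Y" and le: "\<And>y. y \<in> Y \<Longrightarrow> z y \<le> z' y + c"
  shows "lower_exp Y K z \<le> lower_exp Y K z' + c"
proof -
  have "lower_exp Y K z - c \<le> (\<Sum>y\<in>Y. q y * z' y)" if "q \<in> K" for q
    using lower_exp_lower[OF assms(2) that, of z]
      prob_simplex_expectation_mono[of q Y z z' c] le that assms(2) by fastforce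
  then have "lower_exp Y K z - c \<le> lower_exp Y K z'"
    unfolding lower_exp_def[of Y K z'] using assms(1) by (intro cINF_greatest)
  then show ?thesis by simp
qed

lemma lower_exp_nonexpansive:
  assumes "K \<noteq> {}" "K \<subseteq> prob_simplex Y" and "\<And>y. y \<in> Y \<Longrightarrow> \<bar>z y - z' y\<bar> \<le> c"
  shows "\<bar>lower_exp Y K z - lower_exp Y K z'\<bar> \<le> c"
proof -
  have "lower_exp Y K z \<le> lower_exp Y K z' + c"
    using assms(3) by (intro lower_exp_mono_shift assms(1,2)) force
  moreover have "lower_exp Y K z' \<le> lower_exp Y K z + c"
    using assms(3) by (intro lower_exp_mono_shift assms(1,2)) force
  ultimately show ?thesis by linarith
qed

lemma lower_exp_zero:
  assumes "K \<noteq> {}" "\<And>y. y \<in> Y \<Longrightarrow> z y = 0"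
  shows "lower_exp Y K z = 0"
  using assms by (simp add: lower_exp_def)

lemma abs_lower_exp_le:
  assumes "K \<noteq> {}" "K \<subseteq> prob_simplex Y" and "\<And>y. y \<in> Y \<Longrightarrow> \<bar>z y\<bar> \<le> c"
  shows "\<bar>lower_exp Y K z\<bar> \<le> c"
  using lower_exp_nonexpansive[of K Y z "\<lambda>_. 0" c] lower_exp_zero[of K Y "\<lambda>_. 0"] assms by simp

lemma lower_exp_scale_ge:
  assumes "K \<noteq> {}" "K \<subseteq> prob_simplex Y" "0 < c"
  shows "c * lower_exp Y K z \<le> lower_exp Y K (\<lambda>y. c * z y)"
proof -
  have "c * lower_exp Y K z \<le> (\<Sum>y\<in>Y. q y * (c * z y))" if "q \<in> K" for q
  proof -
    have "c * lower_exp Y K z \<le> c * (\<Sum>y\<in>Y. q y * z y)"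
      using lower_exp_lower[OF assms(2) that] assms(3) by (simp add: mult_left_mono)
    also have "\<dots> = (\<Sum>y\<in>Y. q y * (c * z y))"
      by (simp add: sum_distrib_left mult.left_commute)
    finally show ?thesis .
  qed
  then show ?thesis
    unfolding lower_exp_def[of Y K "\<lambda>y. c * z y"] using assms(1) by (intro cINF_greatest)
qed

text \<open>The converse of \<open>lower_exp_scale_ge\<close> is that inequality for the factor \<open>1 / c\<close>.\<close>

lemma lower_exp_scale:
  assumes "K \<noteq> {}" "K \<subseteq> prob_simplex Y" "0 < c"
  shows "lower_exp Y K (\<lambda>y. c * z y) = c * lower_exp Y K z"
proof (rule antisym)
  have "1 / c * lower_exp Y K (\<lambda>y. c * z y) \<le> lower_exp Y K (\<lambda>y. 1 / c * (c * z y))"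
    using assms by (intro lower_exp_scale_ge) auto
  also have "(\<lambda>y. 1 / c * (c * z y)) = z" using assms(3) by auto
  finally show "lower_exp Y K (\<lambda>y. c * z y) \<le> c * lower_exp Y K z"
    using assms(3) by (simp add: field_simps)
qed (use assms in \<open>rule lower_exp_scale_ge\<close>)

lemma D_op_upper:
  assumes A: "A \<noteq> {}" "A \<subseteq> prob_simplex Y" and B: "B \<noteq> {}" "B \<subseteq> prob_simplex Y"
    and z: "\<And>y. y \<in> Y \<Longrightarrow> \<bar>z y\<bar> \<le> 1"
  shows "\<bar>lower_exp Y A z - lower_exp Y B z\<bar> \<le> D_op Y A B"
  unfolding D_op_def
proof (rule cSUP_upper)
  show "bdd_above ((\<lambda>z. \<bar>lower_exp Y A z - lower_exp Y B z\<bar>) ` {z. \<forall>y\<in>Y. \<bar>z y\<bar> \<le> 1})"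
  proof (rule bdd_aboveI2)
    fix z assume "z \<in> {z. \<forall>y\<in>Y. \<bar>z y :: real\<bar> \<le> 1}"
    then have "\<bar>lower_exp Y A z\<bar> \<le> 1" "\<bar>lower_exp Y B z\<bar> \<le> 1"
      using A B by (auto intro!: abs_lower_exp_le)
    then show "\<bar>lower_exp Y A z - lower_exp Y B z\<bar> \<le> 2" by linarith
  qed
qed (use z in auto)

lemma D_op_self: "D_op Y A A = 0"
proof -
  have "{z. \<forall>y\<in>Y. \<bar>z y :: real\<bar> \<le> 1} \<noteq> {}" by (auto intro: exI[of _ "\<lambda>_. 0"])
  then show ?thesis by (simp add: D_op_def)
qed

text \<open>
  Lower expectations are positively homogeneous, so an integrand bounded by \<open>b > 0\<close> can be divided
  by \<open>b\<close> to become a test vector of the supremum defining the operational distance.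
\<close>

lemma lower_exp_change_kernels:
  assumes A: "A \<noteq> {}" "A \<subseteq> prob_simplex Y" and B: "B \<noteq> {}" "B \<subseteq> prob_simplex Y"
    and z: "\<And>y. y \<in> Y \<Longrightarrow> \<bar>z y\<bar> \<le> b" and "0 \<le> b"
  shows "\<bar>lower_exp Y A z - lower_exp Y B z\<bar> \<le> b * D_op Y A B"
proof (cases "b = 0")
  case True
  then have "z y = 0" if "y \<in> Y" for y using z[OF that] by simp
  then show ?thesis using lower_exp_zero[of A Y z] lower_exp_zero[of B Y z] A B True by simp
next
  case False
  then have b: "0 < b" using \<open>0 \<le> b\<close> by simp
  define x where "x = (\<lambda>y. z y / b)"
  have zx: "z = (\<lambda>y. b * x y)" using b by (auto simp: x_def)
  have "\<bar>lower_exp Y A x - lower_exp Y B x\<bar> \<le> D_op Y A B"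
    using z b by (intro D_op_upper A B) (simp add: x_def)
  then have "b * \<bar>lower_exp Y A x - lower_exp Y B x\<bar> \<le> b * D_op Y A B"
    using b by simp
  then show ?thesis
    unfolding zx lower_exp_scale[OF A b] lower_exp_scale[OF B b] right_diff_distrib[symmetric]
    using b by (simp add: abs_mult)
qed

section \<open>Histories and their descendants\<close>

lemma length_histories: "h \<in> histories M t \<Longrightarrow> length h = t"
  by (induction t arbitrary: h) auto

lemma
  assumes "controlled_event_tree M" "u < horizon M" "h \<in> histories M u"
  shows finite_actions: "finite (actions M h)"
    and actions_nonempty: "actions M h \<noteq> {}"
    and finite_obs: "a \<in> actions M h \<Longrightarrow> finite (obs M h a)"
    and kernels_nonempty: "a \<in> actions M h \<Longrightarrow> s \<le> u \<Longrightarrow> kernels M s h a \<noteq> {}"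
    and kernels_simplex:
      "a \<in> actions M h \<Longrightarrow> s \<le> u \<Longrightarrow> kernels M s h a \<subseteq> prob_simplex (obs M h a)"
  using assms unfolding controlled_event_tree_def by blast+

lemma discount_pos: "controlled_event_tree M \<Longrightarrow> 0 < discount M"
  by (simp add: controlled_event_tree_def)

lemma obs_nonempty:
  assumes "controlled_event_tree M" "u < horizon M" "h \<in> histories M u" "a \<in> actions M h"
  shows "obs M h a \<noteq> {}"
  using kernels_nonempty[OF assms, of 0] kernels_simplex[OF assms, of 0]
    prob_simplex_nonempty[of _ "obs M h a"] by blast

lemma finite_histories:
  assumes M: "controlled_event_tree M" and "u \<le> horizon M"
  shows "finite (histories M u)"
  using assms(2)
proof (induction u)
  case (Suc u)
  let ?S = "SIGMA h:histories M u. SIGMA a:actions M h. obs M h a"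
  have "histories M (Suc u) = (\<lambda>(h, a, y). (a, y) # h) ` ?S" by force
  moreover have "finite ?S"
    using Suc by (intro finite_SigmaI finite_actions[OF M] finite_obs[OF M]) auto
  ultimately show ?case by simp
qed simp

lemma descendants_subset: "descendants M h j \<subseteq> histories M j"
  by (auto simp: descendants_def)

lemma finite_descendants:
  "controlled_event_tree M \<Longrightarrow> j \<le> horizon M \<Longrightarrow> finite (descendants M h j)"
  using finite_subset[OF descendants_subset finite_histories] .

lemma descendants_self: "h \<in> histories M t \<Longrightarrow> h \<in> descendants M h t"
  by (simp add: descendants_def)

lemma descendants_mono: "suffix h h' \<Longrightarrow> descendants M h' j \<subseteq> descendants M h j"
  by (auto simp: descendants_def intro: suffix_order.order_trans)

text \<open>Every branch reaches the horizon, so that no supremum over descendants is vacuous.\<close>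

lemma descendants_nonempty:
  assumes M: "controlled_event_tree M" and h: "h \<in> histories M t" and "t \<le> j" "j \<le> horizon M"
  shows "descendants M h j \<noteq> {}"
  using assms(3,4)
proof (induction j rule: dec_induct)
  case base
  then show ?case using descendants_self[OF h] by auto
next
  case (step j)
  then obtain g where g: "g \<in> histories M j" "suffix h g" by (auto simp: descendants_def)
  have j: "j < horizon M" using step by simp
  obtain a where a: "a \<in> actions M g" using actions_nonempty[OF M j g(1)] by auto
  obtain y where "y \<in> obs M g a" using obs_nonempty[OF M j g(1) a] by auto
  then have "(a, y) # g \<in> descendants M h (Suc j)"
    using g a by (auto simp: descendants_def suffix_ConsI)
  then show ?case by auto
qed

lemma finite_descendant_actions:
  assumes "controlled_event_tree M" "j < horizon M"
  shows "finite (SIGMA h':descendants M h j. actions M h')"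
  using assms descendants_subset[of M h j]
  by (intro finite_SigmaI finite_descendants) (auto intro: finite_actions)

lemma descendant_actions_nonempty:
  assumes M: "controlled_event_tree M" and h: "h \<in> histories M t" and "t \<le> j" "j < horizon M"
  shows "(SIGMA h':descendants M h j. actions M h') \<noteq> {}"
proof -
  obtain g where g: "g \<in> descendants M h j"
    using descendants_nonempty[OF M h, of j] assms by auto
  then have "actions M g \<noteq> {}"
    using actions_nonempty[OF M \<open>j < horizon M\<close>] descendants_subset by blast
  with g show ?thesis by auto
qed

section \<open>Lipschitz dependence of values on the vintage\<close>

lemma abs_V_le_value_bound:
  assumes M: "controlled_event_tree M" and w: "bounded_rewards M w" and pol: "\<pi> \<in> policies M"
    and "u \<le> horizon M" "h \<in> histories M u" "s \<le> u"
  shows "\<bar>V M w \<pi> s h\<bar> \<le> value_bound M u"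
  using assms(4-6)
proof (induction u arbitrary: h rule: inc_induct)
  case base
  then show ?case
    using w length_histories[of h]
    by (simp add: V.simps value_bound.simps bounded_rewards_def)
next
  case (step u)
  let ?a = "\<pi> h"
  have len: "length h = u" and a: "?a \<in> actions M h"
    using step pol length_histories by (auto simp: policies_def)
  let ?L = "lower_exp (obs M h ?a) (kernels M s h ?a) (\<lambda>y. V M w \<pi> s ((?a, y) # h))"
  note K = kernels_nonempty[OF M \<open>u < horizon M\<close> \<open>h \<in> histories M u\<close> a]
    kernels_simplex[OF M \<open>u < horizon M\<close> \<open>h \<in> histories M u\<close> a]
  have "\<bar>?L\<bar> \<le> value_bound M (Suc u)"
    using step.prems a by (intro abs_lower_exp_le K step.IH) auto
  then have "discount M * \<bar>?L\<bar> \<le> discount M * value_bound M (Suc u)"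
    using discount_pos[OF M] by simp
  moreover have "\<bar>reward w h ?a\<bar> \<le> reward_bound M u"
    using w step a by (auto simp: bounded_rewards_def)
  moreover have "\<bar>V M w \<pi> s h\<bar> \<le> \<bar>reward w h ?a\<bar> + discount M * \<bar>?L\<bar>"
    using step.hyps len discount_pos[OF M] abs_triangle_ineq[of "reward w h ?a" "discount M * ?L"]
    by (simp add: V.simps[of M w \<pi> s h] Q.simps abs_mult)
  ultimately show ?case
    using step.hyps by (simp add: value_bound.simps[of M u])
qed

text \<open>
  The constants \<open>reward_bound M\<close> and \<open>terminal_bound M\<close> are arbitrary reals; that they give
  nonnegative value bounds follows from the existence of a reward system obeying them.
\<close>

lemma value_bound_nonneg:
  assumes M: "controlled_event_tree M" and w: "bounded_rewards M w" and pol: "\<pi> \<in> policies M"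
    and u: "u \<le> horizon M"
  shows "0 \<le> value_bound M u"
proof -
  obtain g where "g \<in> histories M u"
    using descendants_nonempty[OF M, of "[]" 0 u] u by (auto simp: descendants_def)
  then have "\<bar>V M w \<pi> 0 g\<bar> \<le> value_bound M u"
    by (intro abs_V_le_value_bound[OF M w pol u]) auto
  then show ?thesis by linarith
qed

text \<open>
  The recursion of \<open>d_plus\<close>.  It is an inequality because a descendant of the successor
  \<open>(a, y) # h\<close> is a descendant of \<open>h\<close>, so the suprema at later dates can only shrink in
  passing to the successor.
\<close>

lemma d_plus_step:
  assumes M: "controlled_event_tree M" and nonneg: "\<And>u. u \<le> horizon M \<Longrightarrow> 0 \<le> value_bound M u"
    and u: "u < horizon M" and h: "h \<in> histories M u"
    and a: "a \<in> actions M h" and y: "y \<in> obs M h a"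
  shows "discount M * value_bound M (Suc u) * D_op (obs M h a) (kernels M s h a) (kernels M s' h a)
         + discount M * d_plus M ((a, y) # h) s s' \<le> d_plus M h s s'"
proof -
  let ?g = "(a, y) # h"
  let ?D = "\<lambda>(h', a). D_op (obs M h' a) (kernels M s h' a) (kernels M s' h' a)"
  let ?S = "\<lambda>h j. SUP x\<in>(SIGMA h':descendants M h j. actions M h'). ?D x"
  have pos: "0 < discount M" using discount_pos[OF M] .
  have len: "length h = u" using length_histories[OF h] .
  have g: "?g \<in> histories M (Suc u)" using h a y by auto
  have len_g: "length ?g = Suc u" using len by simp
  have bdd: "bdd_above (?D ` (SIGMA h':descendants M h j. actions M h'))"
    if "j < horizon M" for j
    using finite_descendant_actions[OF M that] by (intro bdd_above_finite) auto
  have "?D (h, a) \<le> ?S h u"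
    using descendants_self[OF h] a by (intro cSUP_upper bdd u) auto
  then have head: "discount M * value_bound M (Suc u) * ?D (h, a)
      \<le> discount M * value_bound M (Suc u) * ?S h u"
    using pos nonneg[of "Suc u"] u by (intro mult_left_mono) auto
  have sub: "?S ?g j \<le> ?S h j" if "Suc u \<le> j" "j < horizon M" for j
  proof (rule cSUP_subset_mono)
    show "(SIGMA h':descendants M ?g j. actions M h') \<noteq> {}"
      using descendant_actions_nonempty[OF M g that] .
    have "suffix h ?g" by (simp add: suffix_ConsI)
    then show "(SIGMA h':descendants M ?g j. actions M h')
        \<subseteq> (SIGMA h':descendants M h j. actions M h')"
      using descendants_mono[of h ?g M j] by auto
  qed (use bdd that in auto)
  have "discount M * (discount M ^ (j - Suc u + 1) * value_bound M (j + 1) * ?S ?g j)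
      \<le> discount M ^ (j - u + 1) * value_bound M (j + 1) * ?S h j"
    if "Suc u \<le> j" "j < horizon M" for j
  proof -
    have "j - u + 1 = Suc (j - Suc u + 1)" using that by auto
    then have "discount M * (discount M ^ (j - Suc u + 1) * value_bound M (j + 1) * ?S ?g j)
        = discount M ^ (j - u + 1) * value_bound M (j + 1) * ?S ?g j"
      by (simp only: power_Suc mult.assoc)
    also have "\<dots> \<le> discount M ^ (j - u + 1) * value_bound M (j + 1) * ?S h j"
      using sub[OF that] pos nonneg[of "j + 1"] that by (intro mult_left_mono) auto
    finally show ?thesis .
  qed
  then have tail: "discount M * d_plus M ?g s s'
      \<le> (\<Sum>j = Suc u..<horizon M. discount M ^ (j - u + 1) * value_bound M (j + 1) * ?S h j)"
    unfolding d_plus_def sum_distrib_left len_g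
    by (intro sum_mono) (simp only: atLeastLessThan_iff)
  have "d_plus M h s s' = discount M ^ (u - u + 1) * value_bound M (u + 1) * ?S h u
      + (\<Sum>j = Suc u..<horizon M. discount M ^ (j - u + 1) * value_bound M (j + 1) * ?S h j)"
    unfolding d_plus_def len using u by (rule sum.atLeast_Suc_lessThan)
  then show ?thesis using head tail by simp
qed

text \<open>
  Backward induction on the date.  In the hybrid term vintage \<open>s\<close> evaluates the current step and
  vintage \<open>s'\<close> the continuation: passing to it from the value of \<open>s\<close> costs the discrepancy at
  the successors, and passing from it to the value of \<open>s'\<close> costs the one-step distance.
\<close>

lemma V_vintage_lipschitz:
  assumes M: "controlled_event_tree M" and w: "bounded_rewards M w" and pol: "\<pi> \<in> policies M"
    and "u \<le> horizon M" "h \<in> histories M u" "s \<le> u" "s' \<le> u"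
  shows "\<bar>V M w \<pi> s h - V M w \<pi> s' h\<bar> \<le> d_plus M h s s'"
  using assms(4-7)
proof (induction u arbitrary: h rule: inc_induct)
  case base
  then show ?case using length_histories[of h] by (simp add: V.simps d_plus_def)
next
  case (step u)
  let ?a = "\<pi> h"
  let ?Y = "obs M h ?a"
  let ?K = "\<lambda>s. kernels M s h ?a"
  let ?v = "\<lambda>s y. V M w \<pi> s ((?a, y) # h)"
  let ?b = "value_bound M (Suc u)"
  let ?D = "D_op ?Y (?K s) (?K s')"
  have len: "length h = u" and a: "?a \<in> actions M h"
    using step pol length_histories by (auto simp: policies_def)
  have pos: "0 < discount M" using discount_pos[OF M] .
  have nonneg: "0 \<le> value_bound M u" if "u \<le> horizon M" for u
    using value_bound_nonneg[OF M w pol that] .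
  note K = kernels_nonempty[OF M \<open>u < horizon M\<close> \<open>h \<in> histories M u\<close> a]
    kernels_simplex[OF M \<open>u < horizon M\<close> \<open>h \<in> histories M u\<close> a]
  have succ: "(?a, y) # h \<in> histories M (Suc u)" if "y \<in> ?Y" for y
    using that step.prems a by auto
  \<comment> \<open>the discrepancy at the successors that the bound at \<open>h\<close> leaves room for\<close>
  define c where "c = (d_plus M h s s' - discount M * ?b * ?D) / discount M"
  have c: "discount M * c = d_plus M h s s' - discount M * ?b * ?D"
    using pos by (simp add: c_def)
  have "\<bar>?v s y - ?v s' y\<bar> \<le> c" if y: "y \<in> ?Y" for y
  proof -
    have "discount M * d_plus M ((?a, y) # h) s s' \<le> discount M * c"
      using d_plus_step[OF M nonneg \<open>u < horizon M\<close> \<open>h \<in> histories M u\<close> a y, of s s'] c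
      by simp
    then have "d_plus M ((?a, y) # h) s s' \<le> c" using pos by simp
    moreover have "\<bar>?v s y - ?v s' y\<bar> \<le> d_plus M ((?a, y) # h) s s'"
      using step.prems succ[OF y] by (intro step.IH) auto
    ultimately show ?thesis by linarith
  qed
  then have continuation: "\<bar>lower_exp ?Y (?K s) (?v s) - lower_exp ?Y (?K s) (?v s')\<bar> \<le> c"
    using step.prems by (intro lower_exp_nonexpansive K) auto
  have current: "\<bar>lower_exp ?Y (?K s) (?v s') - lower_exp ?Y (?K s') (?v s')\<bar> \<le> ?b * ?D"
    using step.prems step.hyps succ
    by (intro lower_exp_change_kernels K abs_V_le_value_bound[OF M w pol] nonneg) auto
  have "\<bar>V M w \<pi> s h - V M w \<pi> s' h\<bar>
      = discount M * \<bar>lower_exp ?Y (?K s) (?v s) - lower_exp ?Y (?K s') (?v s')\<bar>"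
    using step.hyps len pos
    by (simp add: V.simps[of M w \<pi> _ h] Q.simps right_diff_distrib[symmetric] abs_mult)
  also have "\<dots> \<le> discount M * (c + ?b * ?D)"
    using continuation current pos by (intro mult_left_mono) linarith+
  also have "\<dots> = d_plus M h s s'" using c by (simp add: distrib_left)
  finally show ?case .
qed

section \<open>Covers and decoding\<close>

lemma d_plus_self:
  assumes M: "controlled_event_tree M" and h: "h \<in> histories M t"
  shows "d_plus M h s s = 0"
  unfolding d_plus_def
proof (rule sum.neutral, rule ballI)
  fix j assume "j \<in> {length h..<horizon M}"
  then have "(SIGMA h':descendants M h j. actions M h') \<noteq> {}"
    using length_histories[OF h] by (intro descendant_actions_nonempty[OF M h]) auto
  then show "discount M ^ (j - length h + 1) * value_bound M (j + 1) *
      (SUP (h', a)\<in>(SIGMA h':descendants M h j. actions M h').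
        D_op (obs M h' a) (kernels M s h' a) (kernels M s h' a)) = 0"
    by (simp add: D_op_self case_prod_unfold)
qed

lemma d_bar_plus_self:
  assumes M: "controlled_event_tree M" and h: "h \<in> histories M t" and t: "t \<le> horizon M"
  shows "d_bar_plus M h s s = 0"
proof -
  let ?G = "\<Union>j\<in>{length h..horizon M}. descendants M h j"
  have "h \<in> ?G" using descendants_self[OF h] length_histories[OF h] t by auto
  then have "?G \<noteq> {}" by blast
  have "d_plus M g s s = 0" if "g \<in> ?G" for g
    using that d_plus_self[OF M] descendants_subset by blast
  then have "d_bar_plus M h s s = (SUP g\<in>?G. 0)"
    unfolding d_bar_plus_def by (intro SUP_cong refl)
  also have "\<dots> = 0" using \<open>?G \<noteq> {}\<close> by (rule cSUP_const)
  finally show ?thesis .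
qed

lemma d_plus_le_d_bar_plus:
  assumes M: "controlled_event_tree M"
    and j: "length h \<le> j" "j \<le> horizon M" and g: "g \<in> descendants M h j"
  shows "d_plus M g s s' \<le> d_bar_plus M h s s'"
  unfolding d_bar_plus_def
proof (rule cSUP_upper)
  show "bdd_above ((\<lambda>h'. d_plus M h' s s') ` (\<Union>j\<in>{length h..horizon M}. descendants M h j))"
    using finite_descendants[OF M] by (intro bdd_above_finite) auto
qed (use j g in auto)

lemma eps_cover_all:
  assumes "\<And>s. d s s = 0" "0 \<le> \<epsilon>"
  shows "eps_cover d t \<epsilon> {0..t}"
  unfolding eps_cover_def
proof (intro conjI allI impI)
  fix s assume "s \<le> t"
  then show "\<exists>r\<in>{0..t}. d s r \<le> \<epsilon>" using assms by (intro bexI[of _ s]) auto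
qed simp

lemma eps_cover_imp_decoder: "eps_cover d t \<epsilon> R \<Longrightarrow> \<exists>\<rho>. decoder d t \<epsilon> R \<rho>"
  unfolding eps_cover_def decoder_def by metis

lemma decoder_eps_coverD:
  assumes "eps_cover d t \<epsilon> R" "decoder d t \<epsilon> R \<rho>" "s \<le> t"
  shows "\<rho> s \<le> t" "d s (\<rho> s) \<le> \<epsilon>"
  using assms by (auto simp: eps_cover_def decoder_def)

lemma N_vit_attained:
  assumes "eps_cover (d_plus M h) (length h) \<epsilon> R\<^sub>0"
  shows "\<exists>R. eps_cover (d_plus M h) (length h) \<epsilon> R \<and> card R = N_vit M h \<epsilon>"
  unfolding N_vit_def by (rule LeastI_ex) (use assms in auto)

section \<open>Maximizers of perturbed action values\<close>

lemma abs_le_of_SUP_le: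
  assumes M: "controlled_event_tree M" and u: "u < horizon M"
    and sup: "(SUP (h', a)\<in>(SIGMA h':histories M u. actions M h'). \<bar>f h' a - g h' a\<bar>) \<le> (e::real)"
    and h: "h \<in> histories M u" and a: "a \<in> actions M h"
  shows "\<bar>f h a - g h a\<bar> \<le> e"
proof -
  have "finite (SIGMA h':histories M u. actions M h')"
    using u by (intro finite_SigmaI finite_histories[OF M]) (auto intro: finite_actions[OF M])
  then have "(case (h, a) of (h', a) \<Rightarrow> \<bar>f h' a - g h' a\<bar>)
      \<le> (SUP (h', a)\<in>(SIGMA h':histories M u. actions M h'). \<bar>f h' a - g h' a\<bar>)"
    using h a by (intro cSUP_upper bdd_above_finite) auto
  then show ?thesis using sup by simp
qed

lemma near_maximizer_of_perturbation:
  fixes f g :: "'a \<Rightarrow> real"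
  assumes max: "is_arg_max f (\<lambda>a. a \<in> A) m" and A: "finite A"
    and near: "\<And>a. a \<in> A \<Longrightarrow> \<bar>g a - f a\<bar> \<le> e"
  shows "(MAX a\<in>A. g a) - 2 * e \<le> g m"
proof -
  have m: "m \<in> A" and le: "\<And>a. a \<in> A \<Longrightarrow> f a \<le> f m"
    using max by (force simp: is_arg_max_def)+
  have "g a \<le> g m + 2 * e" if "a \<in> A" for a
    using near[OF that] near[OF m] le[OF that] by linarith
  moreover have "A \<noteq> {}" using m by auto
  ultimately have "(MAX a\<in>A. g a) \<le> g m + 2 * e" using A by simp
  then show ?thesis by simp
qed

lemma unique_maximizer_of_perturbation:
  fixes f g :: "'a \<Rightarrow> real"
  assumes m: "m \<in> A" and near: "\<And>a. a \<in> A \<Longrightarrow> \<bar>g a - f a\<bar> \<le> e"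
    and gap: "\<And>a. a \<in> A \<Longrightarrow> a \<noteq> m \<Longrightarrow> f m - f a > 2 * e"
  shows "{a. is_arg_max g (\<lambda>a. a \<in> A) a} = {m}"
proof -
  have "g a < g m" if "a \<in> A" "a \<noteq> m" for a
    using near[OF that(1)] near[OF m] gap[OF that] by linarith
  then show ?thesis using m by (force simp: is_arg_max_def)
qed

section \<open>What the values of one vintage depend on\<close>

lemma histories_kernels_update [simp]: "histories (M\<lparr>kernels := K\<rparr>) u = histories M u"
  by (induction u) auto

lemma policies_kernels_update [simp]: "policies (M\<lparr>kernels := K\<rparr>) = policies M"
  by (simp add: policies_def)

text \<open>
  The tree contains only observations following actions that are available, so the recursion started
  inside the tree never leaves it as long as the policy chooses available actions.
\<close>

lemma V_cong:
  assumes K: "\<And>u h a. u < horizon M \<Longrightarrow> h \<in> histories M u \<Longrightarrow> a \<in> actions M h \<Longrightarrow>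
      K s h a = kernels M s h a"
    and pol: "\<pi> \<in> policies M"
    and eq: "\<And>u h. u < horizon M \<Longrightarrow> h \<in> histories M u \<Longrightarrow> \<pi>' h = \<pi> h"
    and "u \<le> horizon M" "h \<in> histories M u"
  shows "V (M\<lparr>kernels := K\<rparr>) w \<pi>' s h = V M w \<pi> s h"
  using assms(4,5)
proof (induction u arbitrary: h rule: inc_induct)
  case base
  then show ?case using length_histories[of h] by (simp add: V.simps)
next
  case (step u)
  let ?a = "\<pi> h"
  let ?E = "lower_exp (obs M h ?a) (kernels M s h ?a)"
  have len: "length h = u" and a: "?a \<in> actions M h"
    using step pol length_histories by (auto simp: policies_def)
  have same: "\<pi>' h = ?a" "K s h ?a = kernels M s h ?a"
    using eq[of u h] K[of u h ?a] step a by auto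
  have "V (M\<lparr>kernels := K\<rparr>) w \<pi>' s ((?a, y) # h) = V M w \<pi> s ((?a, y) # h)"
    if "y \<in> obs M h ?a" for y
    using that step.prems a by (intro step.IH) auto
  then have "?E (\<lambda>y. V (M\<lparr>kernels := K\<rparr>) w \<pi>' s ((?a, y) # h)) = ?E (\<lambda>y. V M w \<pi> s ((?a, y) # h))"
    by (simp add: lower_exp_def)
  then show ?case
    using step.hyps same len
    by (simp add: V.simps[of "M\<lparr>kernels := K\<rparr>" w \<pi>' s h] V.simps[of M w \<pi> s h] Q.simps)
qed

lemma precommitment_value_change_kernels:
  assumes "\<And>u h a. u < horizon M \<Longrightarrow> h \<in> histories M u \<Longrightarrow> a \<in> actions M h \<Longrightarrow>
      K 0 h a = kernels M 0 h a"
  shows "precommitment_value (M\<lparr>kernels := K\<rparr>) w = precommitment_value M w"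
proof -
  have "(\<lambda>\<pi>. V (M\<lparr>kernels := K\<rparr>) w \<pi> 0 []) ` policies M = (\<lambda>\<pi>. V M w \<pi> 0 []) ` policies M"
    using assms by (intro image_cong V_cong[of M K 0 _ _ 0]) auto
  then show ?thesis by (simp add: precommitment_value_def)
qed

section \<open>Recovery from representatives and preservation of equilibria\<close>

theorem theorem6p8:
  fixes M :: "('a, 'y) tree" and t :: nat and h :: "('a, 'y) history"
  assumes "controlled_event_tree M"
    and "t < horizon M"
    and "h \<in> histories M t"
  shows
    "((\<forall>w \<pi> s s'. bounded_rewards M w \<longrightarrow> \<pi> \<in> policies M \<longrightarrow> s \<le> t \<longrightarrow> s' \<le> t \<longrightarrow>
          \<bar>V M w \<pi> s h - V M w \<pi> s' h\<bar> \<le> d_plus M h s s')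
      \<and> (\<forall>\<epsilon>\<ge>0.
          (\<exists>R. eps_cover (d_plus M h) t \<epsilon> R \<and> card R = N_vit M h \<epsilon>) \<and>
          (\<forall>R. eps_cover (d_plus M h) t \<epsilon> R \<longrightarrow>
             (\<exists>\<rho>. decoder (d_plus M h) t \<epsilon> R \<rho>) \<and>
             (\<forall>\<rho> w \<pi>. decoder (d_plus M h) t \<epsilon> R \<rho> \<longrightarrow> bounded_rewards M w \<longrightarrow> \<pi> \<in> policies M \<longrightarrow>
                (\<forall>s\<le>t. \<bar>V M w \<pi> s h - V M w \<pi> (\<rho> s) h\<bar> \<le> \<epsilon>))))
      \<and> (\<forall>\<epsilon>\<ge>0.
          (\<exists>R. eps_cover (d_bar_plus M h) t \<epsilon> R) \<and>
          (\<forall>R. eps_cover (d_bar_plus M h) t \<epsilon> R \<longrightarrow>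
             (\<exists>\<rho>. decoder (d_bar_plus M h) t \<epsilon> R \<rho>) \<and>
             (\<forall>\<rho> w \<pi>. decoder (d_bar_plus M h) t \<epsilon> R \<rho> \<longrightarrow> bounded_rewards M w \<longrightarrow> \<pi> \<in> policies M \<longrightarrow>
                (\<forall>s\<le>t. \<forall>j\<in>{t..horizon M}. \<forall>h'\<in>descendants M h j.
                   \<bar>V M w \<pi> s h' - V M w \<pi> (\<rho> s) h'\<bar> \<le> \<epsilon>)))))
     \<and>
     (\<forall>w \<pi> (Qt :: ('a, 'y) history \<Rightarrow> 'a \<Rightarrow> real) (\<epsilon> :: nat \<Rightarrow> real).
        bounded_rewards M w \<longrightarrow>
        SPE M w \<pi> \<longrightarrow>
        (\<forall>u<horizon M.
           (SUP (h', a)\<in>(SIGMA h':histories M u. actions M h'). \<bar>Qt h' a - Q M w \<pi> u h' a\<bar>) \<le> \<epsilon> u) \<longrightarrow>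
        (\<forall>u<horizon M. \<forall>h'\<in>histories M u.
           Qt h' (\<pi> h') \<ge> (MAX a\<in>actions M h'. Qt h' a) - 2 * \<epsilon> u)
        \<and>
        ((\<forall>u<horizon M. \<forall>h'\<in>histories M u. \<forall>a\<in>actions M h'.
            a \<noteq> \<pi> h' \<longrightarrow> Q M w \<pi> u h' (\<pi> h') - Q M w \<pi> u h' a > 2 * \<epsilon> u) \<longrightarrow>
         (\<forall>u<horizon M. \<forall>h'\<in>histories M u.
            {a. is_arg_max (Qt h') (\<lambda>a. a \<in> actions M h') a} = {\<pi> h'})
         \<and>
         (\<forall>K. (\<forall>u<horizon M. \<forall>h'\<in>histories M u. \<forall>a\<in>actions M h'. K 0 h' a = kernels M 0 h' a) \<longrightarrow>
            precommitment_value (M\<lparr>kernels := K\<rparr>) w = precommitment_value M w \<and>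
            V (M\<lparr>kernels := K\<rparr>) w \<pi> 0 [] = V M w \<pi> 0 [] \<and>
            (\<forall>\<pi>'\<in>policies M.
               (\<forall>u<horizon M. \<forall>h'\<in>histories M u.
                  is_arg_max (Qt h') (\<lambda>a. a \<in> actions M h') (\<pi>' h')) \<longrightarrow>
               price_of_relearning (M\<lparr>kernels := K\<rparr>) w \<pi>' = price_of_relearning M w \<pi>))))"
proof (intro conjI allI impI ballI)
  note M = assms(1)
  have t: "t \<le> horizon M" using assms(2) by simp
  have len: "length h = t" using length_histories[OF assms(3)] .

  show "\<bar>V M w \<pi> s h - V M w \<pi> s' h\<bar> \<le> d_plus M h s s'"
    if "bounded_rewards M w" "\<pi> \<in> policies M" "s \<le> t" "s' \<le> t" for w \<pi> s s'
    using V_vintage_lipschitz[OF M that(1,2) t assms(3) that(3,4)] .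
  show "\<exists>R. eps_cover (d_plus M h) t \<epsilon> R \<and> card R = N_vit M h \<epsilon>" if "0 \<le> \<epsilon>" for \<epsilon>
    using N_vit_attained[OF eps_cover_all[of "d_plus M h", OF d_plus_self[OF M assms(3)] that]]
    unfolding len .
  show "\<exists>\<rho>. decoder (d_plus M h) t \<epsilon> R \<rho>" if "eps_cover (d_plus M h) t \<epsilon> R" for \<epsilon> R
    using eps_cover_imp_decoder[OF that] .
  show "\<bar>V M w \<pi> s h - V M w \<pi> (\<rho> s) h\<bar> \<le> \<epsilon>"
    if "eps_cover (d_plus M h) t \<epsilon> R" "decoder (d_plus M h) t \<epsilon> R \<rho>"
      "bounded_rewards M w" "\<pi> \<in> policies M" "s \<le> t" for \<epsilon> R \<rho> w \<pi> s
    using V_vintage_lipschitz[OF M that(3,4) t assms(3) that(5)]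
      decoder_eps_coverD[OF that(1,2,5)] by (meson order_trans)

  show "\<exists>R. eps_cover (d_bar_plus M h) t \<epsilon> R" if "0 \<le> \<epsilon>" for \<epsilon>
    using eps_cover_all[of "d_bar_plus M h", OF d_bar_plus_self[OF M assms(3) t] that] by blast
  show "\<exists>\<rho>. decoder (d_bar_plus M h) t \<epsilon> R \<rho>" if "eps_cover (d_bar_plus M h) t \<epsilon> R" for \<epsilon> R
    using eps_cover_imp_decoder[OF that] .
  show "\<bar>V M w \<pi> s h' - V M w \<pi> (\<rho> s) h'\<bar> \<le> \<epsilon>"
    if cover: "eps_cover (d_bar_plus M h) t \<epsilon> R" and dec: "decoder (d_bar_plus M h) t \<epsilon> R \<rho>"
      and w: "bounded_rewards M w" "\<pi> \<in> policies M" and s: "s \<le> t"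
      and j: "j \<in> {t..horizon M}" and h': "h' \<in> descendants M h j" for \<epsilon> R \<rho> w \<pi> s j h'
  proof -
    note rep = decoder_eps_coverD[OF cover dec s]
    have "\<bar>V M w \<pi> s h' - V M w \<pi> (\<rho> s) h'\<bar> \<le> d_plus M h' s (\<rho> s)"
      using s j h' rep(1) descendants_subset[of M h j]
      by (intro V_vintage_lipschitz[OF M w, of j]) auto
    also have "\<dots> \<le> d_bar_plus M h s (\<rho> s)"
      using j h' by (intro d_plus_le_d_bar_plus[OF M, of _ j]) (auto simp: len)
    finally show ?thesis using rep(2) by linarith
  qed

  fix w \<pi> and Qt :: "('a, 'y) history \<Rightarrow> 'a \<Rightarrow> real" and \<epsilon> :: "nat \<Rightarrow> real"
  assume spe: "SPE M w \<pi>" and sup: "\<forall>u<horizon M.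
    (SUP (h', a)\<in>(SIGMA h':histories M u. actions M h'). \<bar>Qt h' a - Q M w \<pi> u h' a\<bar>) \<le> \<epsilon> u"
  have pol: "\<pi> \<in> policies M" using spe by (simp add: SPE_def)
  have near: "\<bar>Qt h' a - Q M w \<pi> u h' a\<bar> \<le> \<epsilon> u"
    if "u < horizon M" "h' \<in> histories M u" "a \<in> actions M h'" for u h' a
    using sup that by (intro abs_le_of_SUP_le[OF M, of u Qt "Q M w \<pi> u"]) auto
  show "Qt h' (\<pi> h') \<ge> (MAX a\<in>actions M h'. Qt h' a) - 2 * \<epsilon> u"
    if u: "u < horizon M" and h': "h' \<in> histories M u" for u h'
  proof (rule near_maximizer_of_perturbation)
    show "is_arg_max (Q M w \<pi> u h') (\<lambda>a. a \<in> actions M h') (\<pi> h')"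
      using spe u h' by (simp add: SPE_def)
  qed (use near u h' finite_actions[OF M] in auto)

  assume gap: "\<forall>u<horizon M. \<forall>h'\<in>histories M u. \<forall>a\<in>actions M h'.
        a \<noteq> \<pi> h' \<longrightarrow> Q M w \<pi> u h' (\<pi> h') - Q M w \<pi> u h' a > 2 * \<epsilon> u"
  show unique: "{a. is_arg_max (Qt h') (\<lambda>a. a \<in> actions M h') a} = {\<pi> h'}"
    if u: "u < horizon M" and h': "h' \<in> histories M u" for u h'
  proof (rule unique_maximizer_of_perturbation)
    show "\<pi> h' \<in> actions M h'" using pol u h' by (simp add: policies_def)
  qed (use near gap u h' in auto)

  fix K :: "nat \<Rightarrow> ('a, 'y) history \<Rightarrow> 'a \<Rightarrow> ('y \<Rightarrow> real) set"
  assume K: "\<forall>u<horizon M. \<forall>h'\<in>histories M u. \<forall>a\<in>actions M h'. K 0 h' a = kernels M 0 h' a"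
  show pre: "precommitment_value (M\<lparr>kernels := K\<rparr>) w = precommitment_value M w"
    using K by (intro precommitment_value_change_kernels) auto
  show "V (M\<lparr>kernels := K\<rparr>) w \<pi> 0 [] = V M w \<pi> 0 []"
    using K pol by (intro V_cong[of M K 0 _ _ 0]) auto
  show "price_of_relearning (M\<lparr>kernels := K\<rparr>) w \<pi>' = price_of_relearning M w \<pi>"
    if max: "\<forall>u<horizon M. \<forall>h'\<in>histories M u. is_arg_max (Qt h') (\<lambda>a. a \<in> actions M h') (\<pi>' h')"
    for \<pi>'
  proof -
    have "\<pi>' h' = \<pi> h'" if "u < horizon M" "h' \<in> histories M u" for u h'
      using max unique[OF that] that by blast
    then have "V (M\<lparr>kernels := K\<rparr>) w \<pi>' 0 [] = V M w \<pi> 0 []"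
      using K pol by (intro V_cong[of M K 0 _ _ 0]) auto
    then show ?thesis using pre by (simp add: price_of_relearning_def)
  qed
qed

end
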